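(* Let $R$ be a factorial domain, $a\in R^{\bullet}$, $n\in\mathbb{N}$ and $\underline{f}=(f_i)_{i=1}^n\in(\mathcal{A}(R[X])\setminus R)^n$ a sequence of pairwise non-associated elements of $R[X]$. Set $f=a\prod_{i=1}^n f_i$. Then $$\{u[\![f]\!]\mid u\in\mathcal{A}([\![f]\!])\}=\{u[\![f]\!]\mid u\in\mathcal{A}(R),\ u\mid_R d(f)\}\cup\Big\{\frac{\prod_{i=1}^n f_i^{y_i}}{d(\prod_{i=1}^n f_i^{y_i})}[\![f]\!]\;\Big|\;\underline{y}\in\mathbb{N}_0^n,\ \underline{y}\text{ is }\underline{f}\text{-irreducible}\Big\}.$$
   Context: For a domain $D$, $D^{\bullet}=D\setminus\{0\}$ is a multiplicative monoid; $\mathcal{A}(\cdot)$ denotes the set of atoms (irreducible elements) of a monoid or domain; $x\mid_R y$ means $x$ divides $y$ in $R$. With $K$ a quotient field of $R$ and $X$ an indeterminate over $K$, ${\rm Int}(R)=\{g\in K[X]\mid g(x)\in R\text{ for all }x\in R\}$. For $f\in{\rm Int}(R)^{\bullet}$, $[\![f]\!]=\{g\in{\rm Int}(R)^{\bullet}\mid g\text{ divides }f^k\text{ in }{\rm Int}(R)\text{ for some }k\in\mathbb{N}_0\}$, a submonoid of ${\rm Int}(R)^{\bullet}$. Fix a system $\mathcal{Q}$ of representatives (up to associates) of the prime elements of $R$; for $p\in\mathcal{Q}$, $\mathrm{v}_p:R\to\mathbb{N}_0\cup\{\infty\}$ is the $p$-adic valuation, and $d:{\rm Int}(R)^{\bullet}\to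 R^{\bullet}$ is defined by $d(g)=\prod_{p\in\mathcal{Q}}p^{\min\{\mathrm{v}_p(g(c))\mid c\in R\}}$. For $\underline{f}\in({\rm Int}(R)^{\bullet})^n$, an element $\underline{x}\in\mathbb{N}_0^n\setminus\{\underline{0}\}$ is called $\underline{f}$-irreducible if for all $\underline{y},\underline{z}\in\mathbb{N}_0^n$ with $\underline{x}=\underline{y}+\underline{z}$ and $d(\prod_{i=1}^n f_i^{x_i})=d(\prod_{i=1}^n f_i^{y_i})\,d(\prod_{i=1}^n f_i^{z_i})$ it follows that $\underline{y}=\underline{0}$ or $\underline{z}=\underline{0}$. *)

theory Defs
  imports
    "HOL-Computational_Algebra.Polynomial_Factorial"
    "HOL-Library.Extended_Nat"
begin

text \<open>
  The sort \<open>{factorial_semiring, idom}\<close> describes factorial domains. The normalisation carried by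
  the class is not used below: the system of representatives of the prime elements is an arbitrary
  explicit set \<open>Q\<close>. The ring \<open>R\<close> is the type \<open>'a\<close>, its quotient field is \<open>'a fract\<close>, and
  \<open>R\<close>, \<open>R[X]\<close> are embedded by \<open>to_fract\<close> and \<open>fract_poly\<close>.
\<close>

definition prime_representatives :: "'a::comm_semiring_1 set \<Rightarrow> bool" where
  "prime_representatives Q \<longleftrightarrow>
     (\<forall>q\<in>Q. prime_elem q) \<and> (\<forall>p. prime_elem p \<longrightarrow> (\<exists>!q. q \<in> Q \<and> p dvd q \<and> q dvd p))"

text \<open>The ring \<open>Int(R)\<close> of integer-valued polynomials.\<close>

definition Int_ring :: "'a::idom fract poly set" where
  "Int_ring = {g. \<forall>x. poly g (to_fract x) \<in> range to_fract}"

text \<open>For \<open>g\<close> in \<open>Int(R)\<close> and \<open>c\<close> in \<open>R\<close>: the value \<open>g(c)\<close> as an element of \<open>R\<close>.\<close>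

definition int_value :: "'a::idom fract poly \<Rightarrow> 'a \<Rightarrow> 'a" where
  "int_value g c = inv to_fract (poly g (to_fract c))"

definition dvd_in :: "'b::times set \<Rightarrow> 'b \<Rightarrow> 'b \<Rightarrow> bool" where
  "dvd_in S g h \<longleftrightarrow> (\<exists>q\<in>S. h = g * q)"

text \<open>The monadic submonoid \<open>[[f]]\<close> of \<open>Int(R) - {0}\<close>.\<close>

definition monadic :: "'a::idom fract poly \<Rightarrow> 'a fract poly set" where
  "monadic f = {g \<in> Int_ring - {0}. \<exists>k::nat. dvd_in Int_ring g (f ^ k)}"

definition monoid_units :: "'b::comm_monoid_mult set \<Rightarrow> 'b set" where
  "monoid_units H = {u \<in> H. \<exists>v\<in>H. u * v = 1}"

definition monoid_atoms :: "'b::comm_monoid_mult set \<Rightarrow> 'b set" where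
  "monoid_atoms H = {u \<in> H. u \<notin> monoid_units H \<and>
     (\<forall>x\<in>H. \<forall>y\<in>H. u = x * y \<longrightarrow> x \<in> monoid_units H \<or> y \<in> monoid_units H)}"

text \<open>The valuation takes values in \<open>enat\<close> because \<open>multiplicity p 0 = 0\<close>.\<close>

definition pval :: "'a::factorial_semiring \<Rightarrow> 'a \<Rightarrow> enat" where
  "pval p x = (if x = 0 then \<infinity> else enat (multiplicity p x))"

text \<open>
  The infimum below is a minimum, as \<open>enat\<close> is well-ordered. It is infinite only if \<open>g\<close> vanishes on
  \<open>R\<close>, which for \<open>g \<noteq> 0\<close> forces \<open>R\<close> to be a finite field, so that there are no primes.
\<close>

definition min_pval :: "'a::{factorial_semiring, idom} \<Rightarrow> 'a fract poly \<Rightarrow> nat" where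
  "min_pval p g = the_enat (INF c. pval p (int_value g c))"

text \<open>
  The product is restricted to the nontrivial factors, of which there are finitely many for
  \<open>g \<noteq> 0\<close>, because \<open>prod\<close> over an infinite index set is \<open>1\<close> by convention.
\<close>

definition fixed_div :: "'a::{factorial_semiring, idom} set \<Rightarrow> 'a fract poly \<Rightarrow> 'a" where
  "fixed_div Q g = (\<Prod>p\<in>{p \<in> Q. min_pval p g \<noteq> 0}. p ^ min_pval p g)"

text \<open>Elements of \<open>\<nat>\<^sub>0\<^sup>n\<close> are functions on \<open>nat\<close> vanishing outside \<open>{1..n}\<close>.\<close>

definition exponents :: "nat \<Rightarrow> (nat \<Rightarrow> nat) set" where
  "exponents n = {x. \<forall>i. i \<notin> {1..n} \<longrightarrow> x i = 0}"

definition power_prod :: "nat \<Rightarrow> (nat \<Rightarrow> 'b::comm_monoid_mult) \<Rightarrow> (nat \<Rightarrow> nat) \<Rightarrow> 'b" where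
  "power_prod n f x = (\<Prod>i=1..n. f i ^ x i)"

definition seq_irreducible ::
  "'a::{factorial_semiring, idom} set \<Rightarrow> nat \<Rightarrow> (nat \<Rightarrow> 'a fract poly) \<Rightarrow> (nat \<Rightarrow> nat) \<Rightarrow> bool" where
  "seq_irreducible Q n f x \<longleftrightarrow>
     x \<in> exponents n \<and> x \<noteq> (\<lambda>_. 0) \<and>
     (\<forall>y\<in>exponents n. \<forall>z\<in>exponents n.
        x = (\<lambda>i. y i + z i) \<and>
        fixed_div Q (power_prod n f x) =
          fixed_div Q (power_prod n f y) * fixed_div Q (power_prod n f z) \<longrightarrow>
        y = (\<lambda>_. 0) \<or> z = (\<lambda>_. 0))"

end

theory Submission
  imports Defs
begin

text \<open>
  The fixed divisor \<open>d(g)\<close> is a greatest common divisor of the values of \<open>g\<close> on \<open>R\<close>, so for \<open>r\<close> in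
  \<open>K\<close> the product \<open>r g\<close> is integer-valued iff \<open>r d(g)\<close> lies in \<open>R\<close>. By Gauss's lemma the \<open>f\<^sub>i\<close> are
  pairwise non-associated primes of \<open>K[X]\<close>, whence the elements of \<open>[[f]]\<close> are exactly the products
  \<open>s E(y)\<close> with \<open>s\<close> a constant in \<open>[[f]]\<close> and \<open>E(y)\<close> the quotient of \<open>f\<^sub>1^y\<^sub>1 \<dots> f\<^sub>n^y\<^sub>n\<close> by its
  fixed divisor. Such a product is an atom only if \<open>y = 0\<close> and \<open>s\<close> is irreducible, or \<open>s\<close> is a unit and
  \<open>y \<noteq> 0\<close>. In the second case \<open>E(x) E(z) = c E(x + z)\<close> with \<open>c = d(x + z) / (d(x) d(z))\<close> in \<open>R\<close>,
  so the factorisations of \<open>E(y)\<close> up to units are the decompositions \<open>y = x + z\<close> for which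
  \<open>c\<close> is a unit, that is \<open>c = 1\<close>.
\<close>

section \<open>Integer-valued polynomials\<close>

lemma range_to_fract_mult:
  "x \<in> range to_fract \<Longrightarrow> y \<in> range to_fract \<Longrightarrow> x * y \<in> range to_fract"
  by (metis (no_types, opaque_lifting) imageE rangeI to_fract_mult)

lemma fract_cases:
  fixes x :: "'a::idom fract"
  obtains b c where "c \<noteq> 0" "x = to_fract b / to_fract c"
  by (cases x) (auto simp: Fract_conv_to_fract)

lemma to_fract_power: "to_fract (x ^ k) = to_fract x ^ k"
  by (induction k) simp_all

lemma fract_poly_prod: "fract_poly (prod f A) = (\<Prod>i\<in>A. fract_poly (f i))"
  by (induction A rule: infinite_finite_induct) simp_all

lemma fract_poly_power: "fract_poly (p ^ k) = fract_poly p ^ k"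
  by (induction k) simp_all

lemma poly_fract_poly: "poly (fract_poly p) (to_fract x) = to_fract (poly p x)"
  by (induction p) (simp_all add: map_poly_pCons)

lemma degree_fract_poly [simp]: "degree (fract_poly p) = degree p"
  by (simp add: degree_map_poly)

lemma Int_ring_mult: "g \<in> Int_ring \<Longrightarrow> h \<in> Int_ring \<Longrightarrow> g * h \<in> Int_ring"
  by (simp add: Int_ring_def range_to_fract_mult)

lemma fract_poly_in_Int_ring [simp]: "fract_poly p \<in> Int_ring"
  by (simp add: Int_ring_def poly_fract_poly)

lemma one_in_Int_ring [simp]: "1 \<in> Int_ring"
  using fract_poly_in_Int_ring[of 1] by simp

lemma const_in_Int_ring_iff [simp]: "[:x:] \<in> Int_ring \<longleftrightarrow> x \<in> range to_fract"
  by (simp add: Int_ring_def)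

lemma to_fract_int_value:
  "g \<in> Int_ring \<Longrightarrow> to_fract (int_value g c) = poly g (to_fract c)"
  by (auto simp: Int_ring_def int_value_def intro: f_inv_into_f)

lemma int_value_eqI: "poly g (to_fract c) = to_fract v \<Longrightarrow> int_value g c = v"
  by (simp add: int_value_def inv_f_f inj_def)

lemma int_value_mult:
  assumes "g \<in> Int_ring" "h \<in> Int_ring"
  shows "int_value (g * h) c = int_value g c * int_value h c"
  using assms by (intro int_value_eqI) (simp add: to_fract_int_value)

lemma int_value_power:
  assumes "g \<in> Int_ring"
  shows "int_value (g ^ k) c = int_value g c ^ k"
  using assms by (intro int_value_eqI) (simp add: to_fract_int_value to_fract_power)

text \<open>The denominator is cleared at each argument, which turns integrality over
  \<open>K\<close> into divisibility in \<open>R\<close>.\<close>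

lemma smult_in_Int_ring_iff:
  assumes "g \<in> Int_ring" "t \<noteq> 0"
  shows "smult (to_fract s / to_fract t) g \<in> Int_ring \<longleftrightarrow> (\<forall>c. t dvd s * int_value g c)"
proof -
  have "to_fract s / to_fract t * poly g (to_fract c) \<in> range to_fract \<longleftrightarrow> t dvd s * int_value g c"
    for c
  proof -
    have "to_fract s / to_fract t * poly g (to_fract c) = to_fract v
        \<longleftrightarrow> to_fract (s * int_value g c) = to_fract (t * v)" for v
      using assms by (simp add: to_fract_int_value field_simps)
    then show ?thesis
      unfolding to_fract_eq_iff by (auto simp: dvd_def image_iff)
  qed
  then show ?thesis by (simp add: Int_ring_def)
qed


section \<open>The fixed divisor\<close>

text \<open>Transfers valuations between an arbitrary representative in \<open>Q\<close> and the
  normalised primes over which library facts quantify.\<close>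

lemma multiplicity_associated:
  fixes p q :: "'a::factorial_semiring"
  assumes "p dvd q" "q dvd p"
  shows "multiplicity p x = multiplicity q x"
proof -
  have "p ^ k dvd x \<longleftrightarrow> q ^ k dvd x" for k
    using assms dvd_power_same dvd_trans by metis
  then show ?thesis by (simp add: multiplicity_def)
qed

text \<open>The multiplicity of \<open>p\<close> recovers \<open>k\<close> from
  \<open>p ^ k\<close>, so the powers of \<open>p\<close> are pairwise distinct.\<close>

lemma infinite_UNIV_if_prime_elem:
  fixes p :: "'a::{factorial_semiring, idom}"
  assumes "prime_elem p"
  shows "infinite (UNIV :: 'a set)"
proof -
  have "inj (\<lambda>k. p ^ k)"
    by (rule injI) (metis assms multiplicity_prime_power)
  then show ?thesis
    by (rule infinite_super[OF subset_UNIV range_inj_infinite])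
qed

text \<open>A prime makes \<open>R\<close> infinite, so a nonzero polynomial cannot vanish on all of \<open>R\<close>.\<close>

lemma exists_nonzero_int_value:
  fixes p :: "'a::{factorial_semiring, idom}"
  assumes "prime_elem p" "g \<in> Int_ring" "g \<noteq> 0"
  obtains c :: 'a where "int_value g c \<noteq> 0"
proof (rule ccontr)
  assume "\<not> thesis"
  then have "poly g (to_fract c) = 0" for c
    using that to_fract_int_value[OF assms(2), of c] by (metis to_fract_0)
  then have "range to_fract \<subseteq> {x. poly g x = 0}" by auto
  with poly_roots_finite[OF assms(3)] have "finite (range (to_fract :: 'a \<Rightarrow> _))"
    by (rule rev_finite_subset)
  then have "finite (UNIV :: 'a set)"
    by (rule finite_imageD) (simp add: inj_def)
  with infinite_UNIV_if_prime_elem[OF assms(1)] show False by blast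
qed

lemma min_pval_attained:
  fixes p :: "'a::{factorial_semiring, idom}"
  assumes "prime_elem p" "g \<in> Int_ring" "g \<noteq> 0"
  obtains c where "int_value g c \<noteq> 0" "min_pval p g = multiplicity p (int_value g c)"
proof -
  obtain c where c: "int_value g c \<noteq> 0" using exists_nonzero_int_value[OF assms] .
  let ?m = "INF c. pval p (int_value g c)"
  have "?m \<in> range (\<lambda>c. pval p (int_value g c))"
    by (rule wellorder_InfI[of _ "range (\<lambda>c. pval p (int_value g c))"]) auto
  then obtain b where b: "?m = pval p (int_value g b)" by auto
  \<comment> \<open>Comparison with the nonzero value at \<open>c\<close> makes the infimum finite,
    so that \<open>the_enat\<close> is applied to a genuine natural number.\<close>
  have "?m \<le> pval p (int_value g c)" by (rule INF_lower) simp
  with b c have "int_value g b \<noteq> 0" by (auto simp: pval_def split: if_splits)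
  with b that show ?thesis by (auto simp: min_pval_def pval_def)
qed

lemma min_pval_le:
  fixes g :: "'a::{factorial_semiring, idom} fract poly"
  assumes "int_value g c \<noteq> 0"
  shows "min_pval p g \<le> multiplicity p (int_value g c)"
proof -
  have "(INF c. pval p (int_value g c)) \<le> pval p (int_value g c)" by (rule INF_lower) simp
  with assms show ?thesis
    unfolding min_pval_def by (cases "INF c. pval p (int_value g c)") (auto simp: pval_def)
qed

context
  fixes Q :: "'a::{factorial_semiring, idom} set"
  assumes Q: "prime_representatives Q"
begin

lemma prime_elem_representative: "q \<in> Q \<Longrightarrow> prime_elem q"
  using Q by (simp add: prime_representatives_def)

text \<open>A prime is irreducible, so the cofactor is a unit and \<open>p\<close>, \<open>q\<close>
  represent the same class of associates.\<close>

lemma representative_eqI: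
  assumes "p \<in> Q" "q \<in> Q" "p dvd q"
  shows "p = q"
proof -
  obtain k where k: "q = p * k" using assms(3) by blast
  have "is_unit k"
    using irreducibleD[OF prime_elem_imp_irreducible k] assms prime_elem_representative
      prime_elem_not_unit by blast
  then have "q dvd p" using k by (simp add: mult_unit_dvd_iff)
  with assms Q show ?thesis
    unfolding prime_representatives_def by (metis dvd_refl)
qed

text \<open>Every such \<open>p\<close> divides one fixed nonzero value of \<open>g\<close>.
  Finiteness of prime divisors concerns normalised primes, whence the detour through
  \<open>normalize\<close>, which is injective on \<open>Q\<close>.\<close>

lemma finite_min_pval_nonzero:
  assumes "g \<in> Int_ring" "g \<noteq> 0"
  shows "finite {p \<in> Q. min_pval p g \<noteq> 0}"
proof (cases "Q = {}")
  case False
  \<comment> \<open>A prime guarantees a nonzero value of \<open>g\<close>; for empty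
    \<open>Q\<close> the claim is trivial.\<close>
  then obtain p where "p \<in> Q" by blast
  then obtain c where c: "int_value g c \<noteq> 0"
    using exists_nonzero_int_value[OF prime_elem_representative assms] by blast
  have "inj_on normalize Q"
    by (rule inj_onI) (metis representative_eqI associatedD1 dvd_refl)
  moreover have "normalize ` {p \<in> Q. min_pval p g \<noteq> 0} \<subseteq> {p. prime p \<and> p dvd int_value g c}"
  proof safe
    fix p assume p: "p \<in> Q" "min_pval p g > 0"
    from prime_elem_representative[OF p(1)] show "prime (normalize p)" by simp
    show "normalize p dvd int_value g c"
      using min_pval_le[OF c, of p] p not_dvd_imp_multiplicity_0[of p "int_value g c"] by force
  qed
  then have "finite (normalize ` {p \<in> Q. min_pval p g \<noteq> 0})"
    by (rule finite_subset) (rule finite_prime_divisors[OF c])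
  ultimately show ?thesis
    by (metis (no_types, lifting) finite_imageD inj_on_subset mem_Collect_eq subsetI)
qed auto

lemma fixed_div_nonzero: "fixed_div Q g \<noteq> 0"
proof (cases "finite {p \<in> Q. min_pval p g \<noteq> 0}")
  case True
  then show ?thesis by (auto simp: fixed_div_def dest: prime_elem_representative)
qed (simp add: fixed_div_def)

text \<open>Distinct elements of \<open>Q\<close> do not divide each other, so only the factor at
  \<open>q\<close> contributes.\<close>

lemma multiplicity_fixed_div:
  assumes "q \<in> Q" "g \<in> Int_ring" "g \<noteq> 0"
  shows "multiplicity q (fixed_div Q g) = min_pval q g"
proof -
  let ?S = "{p \<in> Q. min_pval p g \<noteq> 0}"
  note fin = finite_min_pval_nonzero[OF assms(2,3)]
  have "multiplicity q (fixed_div Q g) = (\<Sum>p\<in>?S. multiplicity q (p ^ min_pval p g))"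
    unfolding fixed_div_def
    by (rule prime_elem_multiplicity_prod_distrib)
      (use assms fin in \<open>auto dest: prime_elem_representative\<close>)
  also have "\<dots> = (\<Sum>p\<in>?S. if p = q then min_pval q g else 0)"
  proof (rule sum.cong)
    fix p assume p: "p \<in> ?S"
    show "multiplicity q (p ^ min_pval p g) = (if p = q then min_pval q g else 0)"
    proof (cases "p = q")
      case True
      then show ?thesis using assms(1) by (simp add: prime_elem_representative)
    next
      case False
      then have "\<not> q dvd p" using representative_eqI assms(1) p by auto
      then show ?thesis
        using False prime_elem_dvd_power prime_elem_representative assms(1)
        by (auto intro!: not_dvd_imp_multiplicity_0)
    qed
  qed simp
  also have "\<dots> = min_pval q g" using fin assms(1) by auto
  finally show ?thesis .
qed

lemma prime_representative:
  assumes "prime_elem p"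
  obtains q where "q \<in> Q" "p dvd q" "q dvd p"
  using assms Q unfolding prime_representatives_def by metis

text \<open>Every prime is associated to an element of \<open>Q\<close>, and multiplicities do not
  distinguish associated primes.\<close>

lemma dvd_if_multiplicity_representatives_le:
  assumes "x \<noteq> 0" "\<And>q. q \<in> Q \<Longrightarrow> multiplicity q x \<le> multiplicity q y"
  shows "x dvd y"
proof (rule multiplicity_le_imp_dvd[OF assms(1)])
  fix p :: 'a assume "prime p"
  then have "prime_elem p" by simp
  then obtain q where q: "q \<in> Q" "p dvd q" "q dvd p" by (rule prime_representative)
  then show "multiplicity p x \<le> multiplicity p y"
    using assms(2)[of q] multiplicity_associated[of p q] by simp
qed

lemma fixed_div_dvd_int_value:
  assumes "g \<in> Int_ring" "g \<noteq> 0"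
  shows "fixed_div Q g dvd int_value g c"
proof (cases "int_value g c = 0")
  case False
  then show ?thesis
    by (intro dvd_if_multiplicity_representatives_le)
      (simp_all add: fixed_div_nonzero multiplicity_fixed_div assms min_pval_le)
qed simp

text \<open>This is the gcd property of the fixed divisor, scaled by \<open>s\<close>. It is checked
  at one \<open>q\<close> at a time, using an argument \<open>c\<close> at which the minimal
  valuation for \<open>q\<close> is attained; \<open>c\<close> may vary with
  \<open>q\<close>.\<close>

lemma dvd_mult_fixed_div:
  assumes "g \<in> Int_ring" "g \<noteq> 0" "s \<noteq> 0" "t \<noteq> 0" "\<And>c. t dvd s * int_value g c"
  shows "t dvd s * fixed_div Q g"
proof (rule dvd_if_multiplicity_representatives_le[OF assms(4)])
  fix q assume q: "q \<in> Q"
  then obtain c where c: "int_value g c \<noteq> 0" "min_pval q g = multiplicity q (int_value g c)"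
    using min_pval_attained[OF prime_elem_representative assms(1,2)] by blast
  have "multiplicity q t \<le> multiplicity q (s * int_value g c)"
    by (rule dvd_imp_multiplicity_le) (use assms c in auto)
  then show "multiplicity q t \<le> multiplicity q (s * fixed_div Q g)"
    using q assms c
    by (simp add: prime_elem_multiplicity_mult_distrib prime_elem_representative
        multiplicity_fixed_div fixed_div_nonzero)
qed

lemma dvd_fixed_div_iff:
  assumes "g \<in> Int_ring" "g \<noteq> 0" "t \<noteq> 0"
  shows "t dvd fixed_div Q g \<longleftrightarrow> (\<forall>c. t dvd int_value g c)"
  using dvd_mult_fixed_div[OF assms(1,2), of 1 t] fixed_div_dvd_int_value[OF assms(1,2)] assms(3)
  by (auto intro: dvd_trans)

lemma fixed_div_mult_dvd:
  assumes "g \<in> Int_ring" "g \<noteq> 0" "h \<in> Int_ring" "h \<noteq> 0"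
  shows "fixed_div Q g * fixed_div Q h dvd fixed_div Q (g * h)"
  using assms
  by (simp add: dvd_fixed_div_iff Int_ring_mult fixed_div_nonzero int_value_mult mult_dvd_mono
      fixed_div_dvd_int_value)

text \<open>Fixed divisors are products of elements of \<open>Q\<close>, hence equal as soon as they are associated.\<close>

lemma fixed_div_mult_eqI:
  assumes "g \<in> Int_ring" "g \<noteq> 0" "h \<in> Int_ring" "h \<noteq> 0"
    and "fixed_div Q (g * h) dvd fixed_div Q g * fixed_div Q h"
  shows "fixed_div Q (g * h) = fixed_div Q g * fixed_div Q h"
proof -
  have gh: "g * h \<in> Int_ring" "g * h \<noteq> 0" using assms by (simp_all add: Int_ring_mult)
  have val: "min_pval q (g * h) = min_pval q g + min_pval q h" if q: "q \<in> Q" for q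
  proof -
    have "multiplicity q (fixed_div Q (g * h)) = multiplicity q (fixed_div Q g * fixed_div Q h)"
      using assms(5) fixed_div_mult_dvd[OF assms(1-4)]
      by (intro antisym dvd_imp_multiplicity_le) (simp_all add: fixed_div_nonzero)
    then show ?thesis
      using q assms gh
      by (simp add: prime_elem_multiplicity_mult_distrib prime_elem_representative
        multiplicity_fixed_div fixed_div_nonzero)
  qed
  let ?S = "{p \<in> Q. min_pval p (g * h) \<noteq> 0}"
  \<comment> \<open>By \<open>val\<close>, each prime occurring for \<open>g\<close> or
    \<open>h\<close> occurs for \<open>g * h\<close>, so all three products can run over
    \<open>?S\<close>.\<close>
  have ext: "fixed_div Q k = (\<Prod>p\<in>?S. p ^ min_pval p k)" if "k = g \<or> k = h" for k
    unfolding fixed_div_def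
    by (rule prod.mono_neutral_left) (use finite_min_pval_nonzero[OF gh] that val in auto)
  show ?thesis
    unfolding ext[of g, simplified] ext[of h, simplified]
    by (simp add: fixed_div_def prod.distrib[symmetric] power_add[symmetric] val)
qed

lemma fixed_div_one: "fixed_div Q 1 = 1"
proof -
  have "min_pval q (1 :: 'a fract poly) = 0" if "q \<in> Q" for q
  proof -
    have "int_value (1 :: 'a fract poly) c = 1" for c
      by (rule int_value_eqI) simp
    then show ?thesis
      using min_pval_le[of 1 0 q] by simp
  qed
  then show ?thesis by (simp add: fixed_div_def)
qed

end


section \<open>Factorisation in \<open>K[X]\<close>\<close>

text \<open>A form of Gauss's lemma: the primes of \<open>c\<close> are removed one at a time, each
  dividing \<open>g\<close> or \<open>h\<close> because it stays prime in \<open>R[X]\<close>. The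
  scalars \<open>a\<close> and \<open>b\<close> collect what is split off.\<close>

lemma smult_eq_multE:
  fixes q :: "'a::{factorial_semiring, idom} poly"
  assumes "c \<noteq> 0" "smult c q = g * h"
  obtains a b g' h' where "q = g' * h'" "g = smult a g'" "h = smult b h'"
proof -
  have "\<exists>a b g' h'. q = g' * h' \<and> g = smult a g' \<and> h = smult b h'"
    using assms
  proof (induction c arbitrary: g h rule: prime_divisors_induct)
    case (unit c)
    then obtain d where d: "1 = c * d" by blast
    have "q = smult d (smult c q)" using d by (simp add: mult.commute)
    also have "\<dots> = smult d g * h" using unit.prems by simp
    finally have "q = smult d g * h" .
    moreover have "g = smult c (smult d g)" "h = smult 1 h" using d by simp_all
    ultimately show ?case by blast
  next
    case (factor p c)
    then have p: "prime_elem [:p:]" "p \<noteq> 0" "c \<noteq> 0" by (auto intro: lift_prime_elem_poly)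
    have p0: "[:p:] \<noteq> 0" using p(2) by simp
    have "g * h = [:p:] * smult c q" using factor.prems by (simp add: mult.commute)
    then have "[:p:] dvd g * h" by (rule dvdI)
    then have "[:p:] dvd g \<or> [:p:] dvd h" by (rule prime_elem_dvd_multD[OF p(1)])
    then consider g' where "g = smult p g'" | h' where "h = smult p h'"
      by (auto elim!: dvdE)
    then show ?case
    proof cases
      case 1
      then have "[:p:] * smult c q = [:p:] * (g' * h)"
        using factor.prems by (simp add: mult.commute)
      then have "smult c q = g' * h" unfolding mult_left_cancel[OF p0] .
      with factor.IH[of g' h] p(3) obtain a b g'' h''
        where "q = g'' * h''" "g' = smult a g''" "h = smult b h''" by blast
      with 1 show ?thesis by (metis smult_smult)
    next
      case 2
      then have "[:p:] * smult c q = [:p:] * (g * h')"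
        using factor.prems by (simp add: mult.commute)
      then have "smult c q = g * h'" unfolding mult_left_cancel[OF p0] .
      with factor.IH[of g h'] p(3) obtain a b g'' h''
        where "q = g'' * h''" "g = smult a g''" "h' = smult b h''" by blast
      with 2 show ?thesis by (metis smult_smult)
    qed
  qed simp
  with that show thesis by blast
qed

lemma clear_denominators:
  fixes p :: "'a::idom fract poly"
  obtains c q where "c \<noteq> 0" "smult (to_fract c) p = fract_poly q"
proof -
  have "\<exists>c q. c \<noteq> 0 \<and> smult (to_fract c) p = fract_poly q"
  proof (induction p)
    case (pCons x p)
    then obtain c q where c: "c \<noteq> 0" "smult (to_fract c) p = fract_poly q" by blast
    obtain b d where d: "d \<noteq> 0" "x = to_fract b / to_fract d" by (rule fract_cases)
    have "smult (to_fract (d * c)) (pCons x p)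
        = pCons (to_fract (c * b)) (smult (to_fract d) (smult (to_fract c) p))"
      using d by simp
    also have "\<dots> = fract_poly (pCons (c * b) (smult d q))"
      unfolding c by (simp add: map_poly_pCons)
    finally show ?case using c(1) d(1) by (metis mult_eq_0_iff)
  next
    case 0
    show ?case by (rule exI[of _ 1], rule exI[of _ 0]) simp
  qed
  with that show thesis by blast
qed

text \<open>Clearing denominators in \<open>fract_poly f = g * h\<close> and applying
  \<open>smult_eq_multE\<close> yields a factorisation of \<open>f\<close> over \<open>R\<close>
  with factors of the same degrees. One of them is a unit, hence constant, and nonzero constants are
  units over \<open>K\<close>.\<close>

lemma irreducible_fract_poly:
  fixes f :: "'a::{factorial_semiring, idom} poly"
  assumes "irreducible f" "degree f > 0"
  shows "irreducible (fract_poly f)"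
proof (rule irreducibleI)
  show f0: "fract_poly f \<noteq> 0" using assms by auto
  show "\<not> fract_poly f dvd 1"
    using assms(2) by (subst is_unit_iff_degree[OF f0]) simp
next
  fix g h assume gh: "fract_poly f = g * h"
  obtain c g1 where g: "c \<noteq> 0" "smult (to_fract c) g = fract_poly g1" by (rule clear_denominators)
  obtain d h1 where h: "d \<noteq> 0" "smult (to_fract d) h = fract_poly h1" by (rule clear_denominators)
  have "fract_poly (smult (c * d) f) = smult (to_fract c) g * smult (to_fract d) h"
    by (simp add: gh mult.commute)
  then have "fract_poly (smult (c * d) f) = fract_poly (g1 * h1)"
    by (simp only: g h fract_poly_mult)
  then have "smult (c * d) f = g1 * h1" by (simp only: fract_poly_eq_iff)
  with _ obtain a b g2 h2 where f: "f = g2 * h2" "g1 = smult a g2" "h1 = smult b h2"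
    by (rule smult_eq_multE) (use g h in simp)
  have nz: "g \<noteq> 0" "h \<noteq> 0" using gh assms by auto
  then have "g1 \<noteq> 0" "h1 \<noteq> 0" using g h by auto
  then have "degree g2 = degree g1" "degree h2 = degree h1" using f by auto
  moreover have "degree g1 = degree g"
    using g by (metis degree_fract_poly degree_smult_eq to_fract_eq_0_iff)
  moreover have "degree h1 = degree h"
    using h by (metis degree_fract_poly degree_smult_eq to_fract_eq_0_iff)
  moreover have "degree g2 = 0 \<or> degree h2 = 0"
    using irreducibleD[OF assms(1) f(1)] by (auto simp: is_unit_poly_iff)
  ultimately show "g dvd 1 \<or> h dvd 1"
    using nz by (simp add: is_unit_iff_degree)
qed

text \<open>Used to carry non-association of the \<open>f i\<close> from \<open>R[X]\<close> to
  \<open>K[X]\<close>. After clearing denominators, \<open>smult_eq_multE\<close> gives a divisor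
  \<open>f'\<close> of \<open>q\<close> of which \<open>f\<close> is a scalar multiple.\<close>

lemma irreducible_dvd_if_fract_poly_dvd:
  fixes f :: "'a::{factorial_semiring, idom} poly"
  assumes "irreducible f" "degree f > 0" "fract_poly f dvd fract_poly q"
  shows "f dvd q"
proof -
  obtain h where h: "fract_poly q = fract_poly f * h" using assms(3) by blast
  obtain c h1 where c: "c \<noteq> 0" "smult (to_fract c) h = fract_poly h1" by (rule clear_denominators)
  have "fract_poly (smult c q) = fract_poly f * smult (to_fract c) h" by (simp add: h)
  then have "fract_poly (smult c q) = fract_poly (f * h1)" by (simp only: c fract_poly_mult)
  then have "smult c q = f * h1" by (simp only: fract_poly_eq_iff)
  with c(1) obtain a b f' h' where q: "q = f' * h'" "f = smult a f'" "h1 = smult b h'"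
    by (rule smult_eq_multE)
  have f: "f = [:a:] * f'" using q by simp
  then have "[:a:] dvd 1 \<or> f' dvd 1" by (rule irreducibleD[OF assms(1)])
  \<comment> \<open>\<open>f'\<close> has positive degree like \<open>f\<close>, so the scalar
    \<open>a\<close> is the unit and \<open>f'\<close> is associated to \<open>f\<close>.\<close>
  moreover have "\<not> f' dvd 1"
  proof
    assume "f' dvd 1"
    then have "degree f' = 0" by (auto elim: is_unit_polyE)
    with assms(2) q(2) degree_smult_le[of a f'] show False by simp
  qed
  ultimately obtain d where "1 = [:a:] * d" by blast
  moreover have "f * d = ([:a:] * d) * f'" unfolding f by (simp only: mult_ac)
  ultimately have "f' = f * d" by simp
  then show ?thesis using q(1) by simp
qed

section \<open>Divisors of products of prime powers\<close>

lemma prime_power_dvdE: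
  fixes p :: "'a::idom"
  assumes "prime_elem p" "g dvd p ^ k * m"
  obtains i g' where "i \<le> k" "g = p ^ i * g'" "g' dvd m"
proof -
  have "\<exists>i g'. i \<le> k \<and> g = p ^ i * g' \<and> g' dvd m" using assms(2)
  proof (induction k arbitrary: g)
    case 0
    then show ?case by (intro exI[of _ 0] exI[of _ g]) simp
  next
    case (Suc k)
    obtain h where h: "p * (p ^ k * m) = g * h" using Suc.prems by (auto simp: mult.assoc)
    then have "p dvd g * h" by (metis dvd_triv_left)
    \<comment> \<open>One factor \<open>p\<close> is cancelled: it comes either out of
      \<open>g\<close>, raising the exponent, or out of the cofactor \<open>h\<close>.\<close>
    then consider g1 where "g = p * g1" | h1 where "h = p * h1"
      using prime_elem_dvd_multD[OF assms(1)] by blast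
    then show ?case
    proof cases
      case 1
      then have "p ^ k * m = g1 * h" using h assms(1) by (simp add: mult.assoc)
      then obtain i g' where "i \<le> k" "g1 = p ^ i * g'" "g' dvd m" using Suc.IH[of g1] by auto
      then show ?thesis using 1 by (intro exI[of _ "Suc i"] exI[of _ g']) (simp add: mult.assoc)
    next
      case 2
      then have "p * (p ^ k * m) = p * (g * h1)" using h by (simp add: mult_ac)
      then have "p ^ k * m = g * h1" using assms(1) by simp
      then show ?thesis using Suc.IH[of g] by (metis dvd_triv_left le_Suc_eq)
    qed
  qed
  with that show thesis by blast
qed

text \<open>The prime powers are peeled off one index at a time. For a unit \<open>u\<close>,
  \<open>w\<close> is a unit too, which in \<open>K[X]\<close> means a nonzero constant.\<close>

lemma dvd_prime_power_prodE:
  fixes p :: "'i \<Rightarrow> 'a::idom"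
  assumes "finite A" "\<And>i. i \<in> A \<Longrightarrow> prime_elem (p i)" "g dvd u * (\<Prod>i\<in>A. p i ^ k i)"
  obtains x w where "\<And>i. i \<notin> A \<Longrightarrow> x i = 0" "g = w * (\<Prod>i\<in>A. p i ^ x i)" "w dvd u"
proof -
  have "\<exists>x w. (\<forall>i. i \<notin> A \<longrightarrow> x i = (0::nat)) \<and> g = w * (\<Prod>i\<in>A. p i ^ x i) \<and> w dvd u"
    using assms
  proof (induction A arbitrary: g rule: finite_induct)
    case empty
    then show ?case by (intro exI[of _ "\<lambda>_. 0"] exI[of _ g]) simp
  next
    case (insert j A)
    have "g dvd p j ^ k j * (u * (\<Prod>i\<in>A. p i ^ k i))"
      using insert by (simp add: mult_ac)
    with insert.prems(1)[OF insertI1] obtain e g'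
      where g': "e \<le> k j" "g = p j ^ e * g'" "g' dvd u * (\<Prod>i\<in>A. p i ^ k i)"
      by (rule prime_power_dvdE)
    obtain x w where
      x: "\<forall>i. i \<notin> A \<longrightarrow> x i = 0" "g' = w * (\<Prod>i\<in>A. p i ^ x i)" "w dvd u"
      using insert.IH[OF _ g'(3)] insert.prems(1) by auto
    have "(\<Prod>i\<in>A. p i ^ (x(j := e)) i) = (\<Prod>i\<in>A. p i ^ x i)"
      using insert.hyps by (intro prod.cong) auto
    then have "g = w * (\<Prod>i\<in>insert j A. p i ^ (x(j := e)) i)"
      using g'(2) x(2) insert.hyps by (simp add: mult_ac)
    with x show ?case by (intro exI[of _ "x(j := e)"] exI[of _ w]) auto
  qed
  with that show thesis by blast
qed

lemma prime_elem_dvd_prodE: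
  assumes "prime_elem p" "finite A" "p dvd prod f A"
  obtains i where "i \<in> A" "p dvd f i"
proof -
  have "\<exists>i\<in>A. p dvd f i" using assms(2,3)
    by (induction A rule: finite_induct)
      (use assms(1) in \<open>auto simp: prime_elem_dvd_mult_iff dest: prime_elem_not_unit\<close>)
  with that show thesis by blast
qed

text \<open>Half of unique factorisation; two applications with the sides exchanged give equal
  exponents.\<close>

lemma prime_power_prod_exponent_le:
  fixes p :: "'i \<Rightarrow> 'a::idom"
  assumes "finite A" "\<And>i. i \<in> A \<Longrightarrow> prime_elem (p i)"
    and nd: "\<And>i j. i \<in> A \<Longrightarrow> j \<in> A \<Longrightarrow> i \<noteq> j \<Longrightarrow> \<not> p i dvd p j"
    and eq: "u * (\<Prod>i\<in>A. p i ^ x i) = v * (\<Prod>i\<in>A. p i ^ y i)" and "v dvd 1" and i: "i \<in> A"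
  shows "x i \<le> y i"
proof (rule ccontr)
  assume "\<not> x i \<le> y i"
  \<comment> \<open>With \<open>Suc e\<close> surplus factors, a copy of \<open>p i\<close> survives
    on the left after cancelling \<open>p i ^ y i\<close>, but it divides neither \<open>v\<close>
    nor any other \<open>p j\<close>.\<close>
  then obtain e where e: "x i = y i + Suc e" by (metis less_iff_Suc_add not_le add_Suc_right)
  let ?X = "\<Prod>j\<in>A - {i}. p j ^ x j" and ?Y = "\<Prod>j\<in>A - {i}. p j ^ y j"
  have pi: "prime_elem (p i)" by (rule assms(2)[OF i])
  have "p i ^ y i * (p i * (u * p i ^ e * ?X)) = u * (\<Prod>i\<in>A. p i ^ x i)"
    by (subst prod.remove[OF assms(1) i]) (simp add: e power_add mult_ac)
  also have "\<dots> = p i ^ y i * (v * ?Y)"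
    unfolding eq by (subst prod.remove[OF assms(1) i]) (simp add: mult_ac)
  finally have "p i * (u * p i ^ e * ?X) = v * ?Y" using pi by simp
  then have "p i dvd v * ?Y" by (metis dvd_triv_left)
  moreover have "\<not> p i dvd v" using pi assms(5) prime_elem_not_unit dvd_trans by blast
  ultimately have "p i dvd ?Y" using prime_elem_dvd_multD[OF pi] by blast
  then obtain j where "j \<in> A - {i}" "p i dvd p j ^ y j"
    using prime_elem_dvd_prodE[OF pi finite_Diff[OF assms(1)]] by blast
  with nd[OF i, of j] prime_elem_dvd_power[OF pi] show False by blast
qed


section \<open>Monadic submonoids\<close>

lemma dvd_in_Int_ring_const:
  assumes "g \<in> Int_ring" "s \<noteq> 0" "\<And>c. s dvd int_value g c"
  shows "dvd_in Int_ring [:to_fract s:] g"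
proof -
  have "smult (to_fract 1 / to_fract s) g \<in> Int_ring"
    by (subst smult_in_Int_ring_iff[OF assms(1,2)]) (use assms(3) in simp)
  moreover have "g = [:to_fract s:] * smult (to_fract 1 / to_fract s) g"
    using assms(2) by simp
  ultimately show ?thesis unfolding dvd_in_def by blast
qed

lemma monadicI:
  assumes "g \<in> Int_ring" "q \<in> Int_ring" "F ^ k = g * q" "F \<noteq> 0"
  shows "g \<in> monadic F"
proof -
  have "g \<noteq> 0" using assms(3,4) by (metis mult_zero_left power_not_zero)
  with assms show ?thesis by (auto simp: monadic_def dvd_in_def)
qed

lemma monadicE:
  assumes "g \<in> monadic F"
  obtains k q where "g \<in> Int_ring" "g \<noteq> 0" "q \<in> Int_ring" "F ^ k = g * q"
  using assms by (auto simp: monadic_def dvd_in_def)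

lemma monadic_mult:
  assumes "g \<in> monadic F" "h \<in> monadic F"
  shows "g * h \<in> monadic F"
proof -
  obtain k q where g: "g \<in> Int_ring" "g \<noteq> 0" "q \<in> Int_ring" "F ^ k = g * q"
    using assms(1) by (rule monadicE)
  obtain l r where h: "h \<in> Int_ring" "h \<noteq> 0" "r \<in> Int_ring" "F ^ l = h * r"
    using assms(2) by (rule monadicE)
  have "F ^ (k + l) = (g * h) * (q * r)" using g h by (simp add: power_add mult_ac)
  moreover have "q * r \<in> Int_ring" using g h by (simp add: Int_ring_mult)
  ultimately have "dvd_in Int_ring (g * h) (F ^ (k + l))" unfolding dvd_in_def by blast
  then show ?thesis
    unfolding monadic_def using g h by (auto simp: Int_ring_mult)
qed

text \<open>The factor \<open>h\<close> is absorbed into the cofactor of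
  \<open>F ^ k\<close>.\<close>

lemma monadic_divisor_closed:
  assumes "g * h \<in> monadic F" "g \<in> Int_ring" "h \<in> Int_ring"
  shows "g \<in> monadic F"
proof -
  obtain k q where q: "g * h \<noteq> 0" "q \<in> Int_ring" "F ^ k = g * h * q"
    using assms(1) by (rule monadicE)
  have "h * q \<in> Int_ring" using q assms by (simp add: Int_ring_mult)
  then show ?thesis
    using q assms by (auto simp: monadic_def dvd_in_def mult.assoc)
qed

text \<open>Both \<open>s\<close> and its inverse divide \<open>1 = F ^ 0\<close>, so both lie in
  \<open>[[f]]\<close>.\<close>

lemma monadic_const_unit:
  assumes "s dvd 1"
  shows "[:to_fract s:] \<in> monoid_units (monadic F)"
proof -
  obtain t where t: "1 = s * t" using assms by blast
  have "[:to_fract s:] * [:to_fract t:] = [:to_fract (s * t):]" by simp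
  then have st: "[:to_fract s:] * [:to_fract t:] = 1" by (simp add: t[symmetric])
  have "1 \<in> monadic F" by (auto simp: monadic_def dvd_in_def intro!: exI[of _ 0])
  then have "[:to_fract s:] \<in> monadic F" "[:to_fract t:] \<in> monadic F"
    using monadic_divisor_closed[of "[:to_fract s:]" "[:to_fract t:]"]
      monadic_divisor_closed[of "[:to_fract t:]" "[:to_fract s:]"] st
    by (simp_all only: const_in_Int_ring_iff rangeI mult.commute[of "[:to_fract t:]"])
  with st show ?thesis unfolding monoid_units_def by blast
qed

text \<open>Evaluating the inverse polynomial at \<open>0\<close> gives an inverse of
  \<open>s\<close> in \<open>R\<close>.\<close>

lemma monadic_const_unitD:
  assumes "[:to_fract s:] \<in> monoid_units (monadic F)"
  shows "s dvd 1"
proof -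
  obtain v where v: "v \<in> Int_ring" "[:to_fract s:] * v = 1"
    using assms by (auto simp: monoid_units_def monadic_def)
  have "to_fract s * poly v (to_fract 0) = 1"
    using arg_cong[OF v(2), of "\<lambda>p. poly p (to_fract 0)"] by simp
  then have "to_fract (s * int_value v 0) = to_fract 1"
    using to_fract_int_value[OF v(1), of 0] by simp
  then have "s * int_value v 0 = 1" unfolding to_fract_eq_iff .
  then show ?thesis by (metis dvd_triv_left)
qed

lemma monoid_units_degree:
  assumes "u \<in> monoid_units (monadic F)"
  shows "degree u = 0"
proof -
  obtain v where "u * v = 1" using assms by (auto simp: monoid_units_def)
  then have "u dvd 1" by (metis dvd_triv_left)
  then show ?thesis by (auto elim: is_unit_polyE)
qed

lemma image_mult_unit:
  assumes "e \<in> monoid_units (monadic F)"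
  shows "(*) (e * g) ` monadic F = (*) g ` monadic F"
proof -
  obtain v where v: "e \<in> monadic F" "v \<in> monadic F" "e * v = 1"
    using assms by (auto simp: monoid_units_def)
  show ?thesis
  proof safe
    fix x assume x: "x \<in> monadic F"
    have "e * g * x = g * (e * x)" by (simp only: mult_ac)
    then show "e * g * x \<in> (*) g ` monadic F"
      using monadic_mult[OF v(1) x] by blast
  next
    fix x assume x: "x \<in> monadic F"
    have "e * g * (v * x) = (e * v) * (g * x)" by (simp only: mult_ac)
    then have "g * x = e * g * (v * x)" using v(3) by simp
    then show "g * x \<in> (*) (e * g) ` monadic F"
      using monadic_mult[OF v(2) x] by blast
  qed
qed

lemma smult_right_cancel:
  fixes p :: "'a::idom poly"
  assumes "p \<noteq> 0"
  shows "smult r p = smult s p \<longleftrightarrow> r = s"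
  using assms by (metis right_minus_eq smult_diff_left smult_eq_0_iff)

section \<open>Normalised products of powers of the \<open>f i\<close> and the shape of the elements
  of \<open>[[f]]\<close>\<close>

context
  fixes Q :: "'a::{factorial_semiring, idom} set"
    and a :: 'a and n :: nat and f :: "nat \<Rightarrow> 'a poly"
    and F :: "'a fract poly" and fK :: "nat \<Rightarrow> 'a fract poly"
    and P E :: "(nat \<Rightarrow> nat) \<Rightarrow> 'a fract poly"
    and d :: "(nat \<Rightarrow> nat) \<Rightarrow> 'a"
  assumes Q: "prime_representatives Q"
    and a0: "a \<noteq> 0"
    and irred: "\<And>i. i \<in> {1..n} \<Longrightarrow> irreducible (f i)"
    and nonconst: "\<And>i. i \<in> {1..n} \<Longrightarrow> f i \<notin> range (\<lambda>c. [:c:])"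
    and nonassoc: "\<And>i j. i \<in> {1..n} \<Longrightarrow> j \<in> {1..n} \<Longrightarrow> i \<noteq> j \<Longrightarrow> \<not> (f i dvd f j \<and> f j dvd f i)"
    and F_def: "F = fract_poly (smult a (\<Prod>i=1..n. f i))"
    and fK_def: "fK = (\<lambda>i. fract_poly (f i))"
    and P_def: "P = power_prod n fK"
    and d_def: "d = (\<lambda>y. fixed_div Q (P y))"
    and E_def: "E = (\<lambda>y. smult (1 / to_fract (d y)) (P y))"
begin

lemma degree_f: "i \<in> {1..n} \<Longrightarrow> degree (f i) > 0"
  using nonconst[of i] degree_eq_zeroE[of "f i"] by blast

lemma prime_fK: "i \<in> {1..n} \<Longrightarrow> prime_elem (fK i)"
  unfolding fK_def
  by (intro field_poly_irreducible_imp_prime irreducible_fract_poly irred degree_f)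

text \<open>Divisibility in \<open>K[X]\<close> descends to \<open>R[X]\<close>, and an irreducible
  element dividing another one is associated to it.\<close>

lemma fK_not_dvd:
  assumes "i \<in> {1..n}" "j \<in> {1..n}" "i \<noteq> j"
  shows "\<not> fK i dvd fK j"
proof
  assume "fK i dvd fK j"
  then have "f i dvd f j"
    unfolding fK_def
    by (rule irreducible_dvd_if_fract_poly_dvd[OF irred[OF assms(1)] degree_f[OF assms(1)]])
  then obtain h where h: "f j = f i * h" by blast
  have "\<not> f i dvd 1" using irred[OF assms(1)] by (rule irreducible_not_unit)
  then have "h dvd 1" using irreducibleD[OF irred[OF assms(2)] h] by blast
  then obtain k where "1 = h * k" by blast
  then have "f i = f j * k" using h by (simp add: mult.assoc)
  then have "f j dvd f i" by (rule dvdI)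
  then show False using nonassoc[OF assms] \<open>f i dvd f j\<close> by blast
qed

lemma P_fract: "P y = fract_poly (power_prod n f y)"
  by (simp add: P_def power_prod_def fK_def fract_poly_prod fract_poly_power)

lemma P_in_Int [simp]: "P y \<in> Int_ring"
  by (simp add: P_fract)

lemma P_nonzero [simp]: "P y \<noteq> 0"
  using prime_fK by (fastforce simp: P_def power_prod_def)

lemma P_zero: "P (\<lambda>_. 0) = 1"
  by (simp add: P_def power_prod_def)

lemma P_add: "P (\<lambda>i. y i + z i) = P y * P z"
  by (simp add: P_def power_prod_def power_add prod.distrib)

lemma F_power: "F ^ k = smult (to_fract (a ^ k)) (P (\<lambda>_. k))"
  by (simp add: F_def P_def fK_def power_prod_def fract_poly_prod smult_power to_fract_power
      prod_power_distrib)

lemma F_nonzero: "F \<noteq> 0"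
  using F_power[of 1] a0 by simp

lemma F_in_Int: "F \<in> Int_ring"
  unfolding F_def by (rule fract_poly_in_Int_ring)

lemma P_degree_zero:
  assumes "y \<in> exponents n" "degree (P y) = 0"
  shows "y = (\<lambda>_. 0)"
proof (rule ext, rule ccontr)
  fix i assume y: "y i \<noteq> 0"
  then have i: "i \<in> {1..n}" using assms(1) by (auto simp: exponents_def)
  have "fK i dvd fK i ^ y i" using y by (simp add: dvd_power)
  also have "\<dots> dvd P y" unfolding P_def power_prod_def using i by (intro dvd_prodI) auto
  finally have "degree (fK i) \<le> degree (P y)" by (rule dvd_imp_degree_le) simp
  then show False using degree_f[OF i] assms(2) by (simp add: fK_def)
qed

text \<open>The nonzero scalars \<open>r\<close> and \<open>s\<close> are units of
  \<open>K[X]\<close>, so the exponent bound applies in both directions.\<close>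

lemma P_inj:
  assumes "x \<in> exponents n" "y \<in> exponents n" "smult r (P x) = smult s (P y)" "r \<noteq> 0" "s \<noteq> 0"
  shows "x = y"
proof
  fix i
  show "x i = y i"
  proof (cases "i \<in> {1..n}")
    case True
    have eq: "[:r:] * (\<Prod>i=1..n. fK i ^ x i) = [:s:] * (\<Prod>i=1..n. fK i ^ y i)"
      using assms(3) by (simp add: P_def power_prod_def)
    have "x i \<le> y i"
      by (rule prime_power_prod_exponent_le[OF _ prime_fK fK_not_dvd eq])
        (use True assms in \<open>auto simp: is_unit_triv\<close>)
    moreover have "y i \<le> x i"
      by (rule prime_power_prod_exponent_le[OF _ prime_fK fK_not_dvd eq[symmetric]])
        (use True assms in \<open>auto simp: is_unit_triv\<close>)
    ultimately show ?thesis by simp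
  qed (use assms in \<open>auto simp: exponents_def\<close>)
qed

lemma d_nonzero [simp]: "d y \<noteq> 0"
  by (simp add: d_def fixed_div_nonzero[OF Q])

lemma d_zero: "d (\<lambda>_. 0) = 1"
  by (simp add: d_def P_zero fixed_div_one[OF Q])

lemma d_add_eqI:
  "d (\<lambda>i. y i + z i) dvd d y * d z \<Longrightarrow> d (\<lambda>i. y i + z i) = d y * d z"
  unfolding d_def P_add by (rule fixed_div_mult_eqI[OF Q]) simp_all

lemma E_zero: "E (\<lambda>_. 0) = 1"
  by (simp add: E_def d_zero P_zero)

lemma const_mult_E: "[:to_fract s:] * E y = smult (to_fract s / to_fract (d y)) (P y)"
  by (simp add: E_def)

lemma E_mult:
  "[:to_fract s:] * E y * ([:to_fract t:] * E z) =
     smult (to_fract (s * t) / to_fract (d y * d z)) (P (\<lambda>i. y i + z i))"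
  by (simp add: E_def P_add mult.commute)

lemma E_in_Int: "E y \<in> Int_ring"
  using smult_in_Int_ring_iff[of "P y" "d y" 1] fixed_div_dvd_int_value[OF Q, of "P y"]
  by (simp add: E_def d_def fixed_div_nonzero[OF Q])

lemma E_degree_zero:
  "y \<in> exponents n \<Longrightarrow> degree (E y) = 0 \<Longrightarrow> y = (\<lambda>_. 0)"
  by (rule P_degree_zero) (simp_all add: E_def)

lemma E_in_monadic: "E y \<in> monadic F"
proof -
  \<comment> \<open>The sum is a convenient common upper bound of the \<open>y i\<close>, so the
    truncated subtraction \<open>k - y i\<close> is exact. The scalar in \<open>q\<close> supplies
    the power of \<open>a\<close> and cancels the denominator of \<open>E y\<close>.\<close>
  define k where "k = sum y {1..n}"
  define q where "q = smult (to_fract (a ^ k * d y)) (P (\<lambda>i. k - y i))"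
  have "q = fract_poly (smult (a ^ k * d y) (power_prod n f (\<lambda>i. k - y i)))"
    by (simp only: q_def P_fract fract_poly_smult)
  then have q: "q \<in> Int_ring" by (simp only: fract_poly_in_Int_ring)
  have "y i + (k - y i) = k" if "i \<in> {1..n}" for i
    using member_le_sum[OF that, of y] by (simp add: k_def)
  then have "P (\<lambda>_. k) = P (\<lambda>i. y i + (k - y i))"
    unfolding P_def power_prod_def by (intro prod.cong) auto
  then have "F ^ k = E y * q"
    by (simp add: F_power P_add q_def E_def)
  from monadicI[OF E_in_Int q this F_nonzero] show ?thesis .
qed

text \<open>Unique factorisation in \<open>K[X]\<close> gives \<open>g = smult r (P y)\<close> with
  \<open>r\<close> in \<open>K\<close>; since \<open>g\<close> is integer-valued, \<open>r\<close>
  times \<open>d y\<close> lies in \<open>R\<close> and serves as \<open>s\<close>.\<close>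

lemma monadic_cases:
  assumes "g \<in> monadic F"
  obtains s y where "s \<noteq> 0" "y \<in> exponents n" "[:to_fract s:] \<in> monadic F"
    "g = [:to_fract s:] * E y"
proof -
  obtain k q where g: "g \<in> Int_ring" "g \<noteq> 0" "q \<in> Int_ring" "F ^ k = g * q"
    using assms by (rule monadicE)
  have "g dvd F ^ k" using g(4) by simp
  then have "g dvd [:to_fract (a ^ k):] * (\<Prod>i=1..n. fK i ^ k)"
    by (simp add: F_power P_def power_prod_def)
  with finite_atLeastAtMost prime_fK obtain y w where y: "\<And>i. i \<notin> {1..n} \<Longrightarrow> y i = 0"
      "g = w * (\<Prod>i=1..n. fK i ^ y i)" "w dvd [:to_fract (a ^ k):]"
    by (rule dvd_prime_power_prodE) auto
  have "degree w = 0" using dvd_imp_degree_le[OF y(3)] a0 by simp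
  then obtain r where r: "w = [:r:]" by (rule degree_eq_zeroE)
  obtain b c where c: "c \<noteq> 0" "r = to_fract b / to_fract c" by (rule fract_cases)
  have gP: "g = smult (to_fract b / to_fract c) (P y)"
    using y(2) by (simp add: r c P_def power_prod_def)
  then have "b \<noteq> 0" using g(2) by auto
  have "\<forall>x. c dvd b * int_value (P y) x"
    using smult_in_Int_ring_iff[OF P_in_Int c(1)] g(1) gP by metis
  then have "c dvd b * d y"
    unfolding d_def using c(1) \<open>b \<noteq> 0\<close> by (intro dvd_mult_fixed_div[OF Q]) auto
  then obtain s where s: "b * d y = c * s" by blast
  then have "to_fract b * to_fract (d y) = to_fract c * to_fract s" by (metis to_fract_mult)
  then have "to_fract b / to_fract c = to_fract s / to_fract (d y)"
    using c(1) by (simp add: frac_eq_eq mult.commute)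
  then have gE: "g = [:to_fract s:] * E y" by (simp only: gP const_mult_E)
  show thesis
  proof (rule that[OF _ _ _ gE])
    show "s \<noteq> 0" using s c(1) \<open>b \<noteq> 0\<close> by auto
    show "y \<in> exponents n" using y(1) by (simp add: exponents_def)
    show "[:to_fract s:] \<in> monadic F"
      using assms unfolding gE by (rule monadic_divisor_closed) (simp_all add: E_in_Int)
  qed
qed

text \<open>A prime \<open>u\<close> dividing a power of a value of \<open>F\<close> divides that
  value, so the arbitrary exponent in \<open>[[f]]\<close> can be replaced by
  \<open>1\<close>.\<close>

lemma irreducible_const_in_monadic_iff:
  assumes "irreducible u"
  shows "[:to_fract u:] \<in> monadic F \<longleftrightarrow> u dvd fixed_div Q F"
proof
  have u: "prime_elem u" "u \<noteq> 0" using assms irreducible_imp_prime_elem by auto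
  show "u dvd fixed_div Q F" if mem: "[:to_fract u:] \<in> monadic F"
  proof -
    obtain k q where q: "[:to_fract u:] \<in> Int_ring" "[:to_fract u:] \<noteq> 0" "q \<in> Int_ring"
        "F ^ k = [:to_fract u:] * q"
      using mem by (rule monadicE)
    have "u dvd int_value F c" for c
    proof -
      have "int_value F c ^ k = int_value [:to_fract u:] c * int_value q c"
        using q F_in_Int by (metis int_value_power int_value_mult const_in_Int_ring_iff rangeI)
      also have "int_value [:to_fract u:] c = u" by (rule int_value_eqI) simp
      finally have "u dvd int_value F c ^ k" by simp
      with u(1) show ?thesis by (rule prime_elem_dvd_power)
    qed
    then show ?thesis by (simp add: dvd_fixed_div_iff[OF Q F_in_Int F_nonzero u(2)])
  qed
  show "[:to_fract u:] \<in> monadic F" if "u dvd fixed_div Q F"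
  proof -
    have "\<And>c. u dvd int_value F c"
      using that by (simp add: dvd_fixed_div_iff[OF Q F_in_Int F_nonzero u(2)])
    then have "dvd_in Int_ring [:to_fract u:] (F ^ 1)"
      using dvd_in_Int_ring_const[OF F_in_Int u(2)] by simp
    then have "\<exists>k. dvd_in Int_ring [:to_fract u:] (F ^ k)" by (rule exI)
    then show ?thesis using u(2) by (simp add: monadic_def)
  qed
qed

section \<open>Classification of the atoms of \<open>[[f]]\<close>\<close>

lemma monadic_const_atom:
  assumes "irreducible u" "[:to_fract u:] \<in> monadic F"
  shows "[:to_fract u:] \<in> monoid_atoms (monadic F)"
  unfolding monoid_atoms_def
proof (intro CollectI conjI ballI impI)
  show "[:to_fract u:] \<notin> monoid_units (monadic F)"
    using assms(1) monadic_const_unitD irreducible_not_unit by blast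
next
  fix g h assume g: "g \<in> monadic F" and h: "h \<in> monadic F" and eq: "[:to_fract u:] = g * h"
  have const: "\<exists>s. k = [:to_fract s:]" if k: "k \<in> monadic F" "degree k = 0" for k
  proof -
    obtain r where "k = [:r:]" using k(2) by (rule degree_eq_zeroE)
    with k(1) show ?thesis by (auto simp: monadic_def)
  qed
  have "g \<noteq> 0" "h \<noteq> 0" using g h by (auto simp: monadic_def)
  \<comment> \<open>The degrees add up to \<open>0\<close>, so both factors are constants, and
    constants in \<open>[[f]]\<close> come from \<open>R\<close>.\<close>
  then have "degree g + degree h = degree [:to_fract u:]" unfolding eq by (simp add: degree_mult_eq)
  then obtain s t where st: "g = [:to_fract s:]" "h = [:to_fract t:]"
    using const g h by force
  then have "to_fract u = to_fract (s * t)" using eq by simp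
  then have "u = s * t" by (simp only: to_fract_eq_iff)
  then have "s dvd 1 \<or> t dvd 1" by (rule irreducibleD[OF assms(1)])
  then show "g \<in> monoid_units (monadic F) \<or> h \<in> monoid_units (monadic F)"
    using st monadic_const_unit by blast
qed (rule assms(2))

lemma seq_irreducible_iff:
  "seq_irreducible Q n fK y \<longleftrightarrow> y \<in> exponents n \<and> y \<noteq> (\<lambda>_. 0) \<and>
     (\<forall>x\<in>exponents n. \<forall>z\<in>exponents n. y = (\<lambda>i. x i + z i) \<and> d y = d x * d z \<longrightarrow>
        x = (\<lambda>_. 0) \<or> z = (\<lambda>_. 0))"
  by (simp add: seq_irreducible_def d_def P_def)

lemma exponents_add: "x \<in> exponents n \<Longrightarrow> z \<in> exponents n \<Longrightarrow> (\<lambda>i. x i + z i) \<in> exponents n"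
  by (simp add: exponents_def)

lemma E_atom:
  assumes irr: "seq_irreducible Q n fK y"
  shows "E y \<in> monoid_atoms (monadic F)"
  unfolding monoid_atoms_def
proof (intro CollectI conjI ballI impI)
  have y: "y \<in> exponents n" "y \<noteq> (\<lambda>_. 0)" using irr by (simp_all add: seq_irreducible_iff)
  show "E y \<notin> monoid_units (monadic F)"
    using y E_degree_zero monoid_units_degree by blast
  fix g h assume gh: "g \<in> monadic F" "h \<in> monadic F" "E y = g * h"
  obtain s x where s: "s \<noteq> 0" "x \<in> exponents n" "g = [:to_fract s:] * E x"
    using gh(1) by (rule monadic_cases)
  obtain t z where t: "t \<noteq> 0" "z \<in> exponents n" "h = [:to_fract t:] * E z"
    using gh(2) by (rule monadic_cases)
  \<comment> \<open>With all scalars collected by \<open>E_mult\<close>, \<open>P_inj\<close>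
    compares the exponents and then \<open>smult_right_cancel\<close> the scalars.\<close>
  have eq: "smult (1 / to_fract (d y)) (P y)
      = smult (to_fract (s * t) / to_fract (d x * d z)) (P (\<lambda>i. x i + z i))"
    using gh(3) unfolding s(3) t(3) E_mult by (simp only: E_def)
  then have yxz: "y = (\<lambda>i. x i + z i)"
    by (rule P_inj[rotated 2]) (use y(1) s t in \<open>simp_all add: exponents_add\<close>)
  then have "1 / to_fract (d y) = to_fract (s * t) / to_fract (d x * d z)"
    using eq by (simp only: smult_right_cancel[OF P_nonzero])
  then have "to_fract (d x * d z) = to_fract (s * t * d y)" by (simp add: field_simps)
  then have dd: "d x * d z = s * t * d y" by (simp only: to_fract_eq_iff)
  \<comment> \<open>\<open>dd\<close> gives one divisibility, and the other holds for all fixed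
    divisors; associated products of elements of \<open>Q\<close> are equal, so the constant
    \<open>s * t\<close> is exactly \<open>1\<close>.\<close>
  then have dy: "d y = d x * d z" using d_add_eqI[of x z] yxz by simp
  then have "s * t = 1" using dd by simp
  then have units: "s dvd 1" "t dvd 1" by (metis dvd_triv_left, metis dvd_triv_right)
  have "x = (\<lambda>_. 0) \<or> z = (\<lambda>_. 0)"
    using irr s(2) t(2) yxz dy by (simp add: seq_irreducible_iff)
  then show "g \<in> monoid_units (monadic F) \<or> h \<in> monoid_units (monadic F)"
  proof
    assume "x = (\<lambda>_. 0)"
    then show ?thesis using s(3) monadic_const_unit[OF units(1)] by (simp add: E_zero)
  next
    assume "z = (\<lambda>_. 0)"
    then show ?thesis using t(3) monadic_const_unit[OF units(2)] by (simp add: E_zero)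
  qed
qed (rule E_in_monadic)

lemma monadic_atom_cases:
  assumes "u \<in> monoid_atoms (monadic F)"
  obtains (const) s where "irreducible s" "[:to_fract s:] \<in> monadic F" "u = [:to_fract s:]"
  | (poly) s y where "s dvd 1" "seq_irreducible Q n fK y" "u = [:to_fract s:] * E y"
proof -
  have u: "u \<in> monadic F" "u \<notin> monoid_units (monadic F)"
    and atom: "\<And>g h. g \<in> monadic F \<Longrightarrow> h \<in> monadic F \<Longrightarrow> u = g * h \<Longrightarrow>
      g \<in> monoid_units (monadic F) \<or> h \<in> monoid_units (monadic F)"
    using assms unfolding monoid_atoms_def by blast+
  obtain s y where s: "s \<noteq> 0" "y \<in> exponents n" "[:to_fract s:] \<in> monadic F"
      "u = [:to_fract s:] * E y"
    using u(1) by (rule monadic_cases)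
  show thesis
  proof (cases "y = (\<lambda>_. 0)")
    case True
    then have us: "u = [:to_fract s:]" using s(4) by (simp add: E_zero)
    have "irreducible s"
    proof (rule irreducibleI[OF s(1)])
      show "\<not> s dvd 1" using u(2) us monadic_const_unit by blast
      fix b c assume bc: "s = b * c"
      \<comment> \<open>Both orders are recorded because \<open>monadic_divisor_closed\<close>
        yields the left factor only.\<close>
      have "u = [:to_fract b:] * [:to_fract c:]" "u = [:to_fract c:] * [:to_fract b:]"
        by (simp_all add: us bc)
      then have "[:to_fract b:] \<in> monadic F" "[:to_fract c:] \<in> monadic F"
        using u(1) monadic_divisor_closed const_in_Int_ring_iff rangeI by metis+
      then have "[:to_fract b:] \<in> monoid_units (monadic F) \<or> [:to_fract c:] \<in> monoid_units (monadic F)"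
        using \<open>u = [:to_fract b:] * [:to_fract c:]\<close> by (rule atom)
      then show "b dvd 1 \<or> c dvd 1" using monadic_const_unitD by blast
    qed
    then show thesis using s(3) us by (rule const)
  next
    case False
    then have nonunit: "E x \<notin> monoid_units (monadic F)" if "x \<in> exponents n" "x \<noteq> (\<lambda>_. 0)" for x
      using that E_degree_zero monoid_units_degree by blast
    \<comment> \<open>\<open>E y\<close> has positive degree and is not a unit, so in the
      factorisation \<open>s(4)\<close> of the atom the constant is.\<close>
    then have unit: "s dvd 1"
      using atom[OF s(3) E_in_monadic s(4)] s(2) False monadic_const_unitD by blast
    have "seq_irreducible Q n fK y"
      unfolding seq_irreducible_iff
    proof (intro conjI ballI impI)
      fix x z assume x: "x \<in> exponents n" and z: "z \<in> exponents n"
        and "y = (\<lambda>i. x i + z i) \<and> d y = d x * d z"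
      then have yxz: "(\<lambda>i. x i + z i) = y" and dxz: "d x * d z = d y" by metis+
      \<comment> \<open>Equality of the fixed divisors makes \<open>E x * E z\<close> equal to
        \<open>E y\<close>; the trivial constant \<open>1\<close> fits the pattern of
        \<open>E_mult\<close>.\<close>
      have "u = [:to_fract s:] * E x * ([:to_fract 1:] * E z)"
        unfolding E_mult yxz dxz unfolding s(4) const_mult_E by simp
      then have "u = ([:to_fract s:] * E x) * E z" by simp
      with monadic_mult[OF s(3) E_in_monadic] E_in_monadic
      have "[:to_fract s:] * E x \<in> monoid_units (monadic F) \<or> E z \<in> monoid_units (monadic F)"
        by (rule atom)
      \<comment> \<open>Units are constant, whereas \<open>E x\<close> is constant only for the zero
        exponent.\<close>
      then have "degree ([:to_fract s:] * E x) = 0 \<or> degree (E z) = 0"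
        by (rule disj_forward) (rule monoid_units_degree, assumption)+
      then have "degree (E x) = 0 \<or> degree (E z) = 0" using s(1) by simp
      then show "x = (\<lambda>_. 0) \<or> z = (\<lambda>_. 0)" using x z E_degree_zero by blast
    qed (use s(2) False in auto)
    then show thesis using unit s(4) poly by blast
  qed
qed

lemma monadic_atom_images:
  "{(*) u ` monadic F | u. u \<in> monoid_atoms (monadic F)} =
    {(*) [:to_fract u:] ` monadic F | u. irreducible u \<and> u dvd fixed_div Q F} \<union>
    {(*) (E y) ` monadic F | y. y \<in> exponents n \<and> seq_irreducible Q n fK y}"
  (is "?L = ?A \<union> ?B")
proof (intro equalityI subsetI)
  fix X assume "X \<in> ?L"
  then obtain u where u: "u \<in> monoid_atoms (monadic F)" "X = (*) u ` monadic F" by blast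
  from u(1) show "X \<in> ?A \<union> ?B"
  proof (cases rule: monadic_atom_cases)
    case (const s)
    then show ?thesis using u(2) irreducible_const_in_monadic_iff by blast
  next
    case (poly s y)
    then have "X = (*) (E y) ` monadic F"
      using u(2) image_mult_unit[OF monadic_const_unit] by blast
    then show ?thesis using poly(2) by (auto simp: seq_irreducible_def)
  qed
next
  fix X assume "X \<in> ?A \<union> ?B"
  then show "X \<in> ?L"
  proof
    assume "X \<in> ?A"
    then obtain u where u: "irreducible u" "u dvd fixed_div Q F"
        "X = (*) [:to_fract u:] ` monadic F"
      by blast
    have "[:to_fract u:] \<in> monoid_atoms (monadic F)"
      by (rule monadic_const_atom[OF u(1)]) (use u irreducible_const_in_monadic_iff in blast)
    with u(3) show ?thesis by blast
  next
    assume "X \<in> ?B"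
    then obtain y where y: "seq_irreducible Q n fK y" "X = (*) (E y) ` monadic F" by blast
    from y(2) E_atom[OF y(1)] show ?thesis by blast
  qed
qed

end

theorem proposition3p5:
  fixes Q :: "'a::{factorial_semiring, idom} set"
    and a :: 'a and n :: nat and f :: "nat \<Rightarrow> 'a poly"
    and F :: "'a fract poly" and fK :: "nat \<Rightarrow> 'a fract poly"
  assumes "prime_representatives Q"
    and "a \<noteq> 0"
    and "n \<ge> 1"
    and "\<And>i. i \<in> {1..n} \<Longrightarrow> irreducible (f i)"
    and "\<And>i. i \<in> {1..n} \<Longrightarrow> f i \<notin> range (\<lambda>c. [:c:])"
    and "\<And>i j. i \<in> {1..n} \<Longrightarrow> j \<in> {1..n} \<Longrightarrow> i \<noteq> j \<Longrightarrow> \<not> (f i dvd f j \<and> f j dvd f i)"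
    and "F = fract_poly (smult a (\<Prod>i=1..n. f i))"
    and "fK = (\<lambda>i. fract_poly (f i))"
  shows "{(*) u ` monadic F | u. u \<in> monoid_atoms (monadic F)} =
    {(*) [:to_fract u:] ` monadic F | u. irreducible u \<and> u dvd fixed_div Q F} \<union>
    {(*) (smult (1 / to_fract (fixed_div Q (power_prod n fK y))) (power_prod n fK y)) ` monadic F
       | y. y \<in> exponents n \<and> seq_irreducible Q n fK y}"
  \<comment> \<open>The three \<open>refl\<close> instantiate \<open>P\<close>, \<open>d\<close> and
    \<open>E\<close> by the right-hand sides of their defining equations.\<close>
  by (rule monadic_atom_images[OF assms(1,2,4-8) refl refl refl])

end
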